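(* Let $\mathbb{F}$ be a field and let $A \in \mathbb{M}_{m,n}$, $B \in \mathbb{M}_{n,p}$, $C \in \mathbb{M}_{p,q}$ be matrices over $\mathbb{F}$. Let $D_B$ be a matrix whose columns are some $\operatorname{rank}(B)$ linearly independent columns of $B$, and let $D_{BC}$ be a matrix whose columns are some $\operatorname{rank}(BC)$ linearly independent columns of $BC$. Let $V_B$ and $V_{BC}$ be matrices whose columns constitute bases for $\operatorname{Ker}(AD_B)$ and $\operatorname{Ker}(AD_{BC})$, respectively. Then $$\operatorname{rank}(ABC) + \operatorname{rank}(B) = \operatorname{rank}(AB) + \operatorname{rank}(BC)$$ if and only if $$D_B V_B = D_{BC} V_{BC} Z$$ for some matrix $Z$ over $\mathbb{F}$ (of the appropriate size).
   Context: $\mathbb{M}_{m,n}$ denotes the space of $m \times n$ matrices over the field $\mathbb{F}$. For a matrix $M \in \mathbb{M}_{m,n}$, $\operatorname{Ker}(M) = \{x \in \mathbb{F}^n : Mx = 0\}$ is its kernel. Matrices with zero rows or columns are allowed (for instance, $V_B$ has no columns when $\operatorname{Ker}(AD_B) = \{0\}$), with the usual convention that a product over an empty inner index is a zero matrix. *)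

theory Defs
  imports "Jordan_Normal_Form.DL_Rank" "Jordan_Normal_Form.Matrix_Kernel"
begin

(* In this library linear independence and bases are properties of sets of vectors.
   "distinct (cols M)" makes them properties of the column family of M: a column
   repeated in M would otherwise be invisible in "set (cols M)". *)

definition max_indep_columns :: "'a::field mat \<Rightarrow> 'a mat \<Rightarrow> bool" where
  "max_indep_columns B D \<longleftrightarrow>
     D \<in> carrier_mat (dim_row B) (vec_space.rank (dim_row B) B) \<and>
     set (cols D) \<subseteq> set (cols B) \<and>
     distinct (cols D) \<and>
     \<not> module.lin_dep class_ring (module_vec TYPE('a) (dim_row B)) (set (cols D))"

(* V may have any number of columns; it has none if the kernel is trivial. *)

definition kernel_basis_mat :: "'a::field mat \<Rightarrow> 'a mat \<Rightarrow> bool" where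
  "kernel_basis_mat M V \<longleftrightarrow>
     dim_row V = dim_col M \<and>
     distinct (cols V) \<and>
     vectorspace.basis class_ring
       ((module_vec TYPE('a) (dim_col M))\<lparr>carrier := mat_kernel M\<rparr>) (set (cols V))"

end

theory Submission
  imports Defs
begin

text \<open>
  The columns of \<open>P = D\<^sub>B V\<^sub>B\<close> form a basis of the part of the column space of \<open>B\<close> that
  \<open>A\<close> annihilates, so by rank-nullity their number is \<open>k = rank B - rank (A B)\<close>; likewise
  \<open>Q = D\<^sub>B\<^sub>C V\<^sub>B\<^sub>C\<close> has \<open>l = rank (B C) - rank (A B C)\<close> independent columns. The column space
  of \<open>B C\<close> lies in that of \<open>B\<close>, hence \<open>Q = P Y\<close> for some injective \<open>Y\<close>. The rank identity
  says \<open>k = l\<close>: then \<open>Y\<close> is square, hence invertible, and \<open>P = Q Y\<^sup>-\<^sup>1\<close>. Conversely, a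
  factorisation \<open>P = Q Z\<close> forces \<open>Z\<close> to be injective, so that \<open>k \<le> l \<le> k\<close>.
\<close>

section \<open>Column space, rank and nullity of a matrix\<close>

lemma col_space_eq_image:
  fixes M :: "'a::field mat"
  assumes "M \<in> carrier_mat nr nc"
  shows "vec_space.col_space nr M = (\<lambda>x. M *\<^sub>v x) ` carrier_vec nc"
  using assms unfolding vec_space.col_space_eq[OF assms] by (auto simp: image_iff)

lemma rank_eq_if_col_space_eq:
  assumes "vec_space.col_space nr M = vec_space.col_space nr N"
  shows "vec_space.rank nr M = vec_space.rank nr N"
  using assms by (simp add: vec_space.rank_def vec_space.col_space_def)

text \<open>Rank-nullity for the linear map that multiplies vectors by \<open>M\<close>: its image
  is the span of the columns, whose dimension is the rank by definition, and its kernel is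
  \<open>mat_kernel M\<close>.\<close>

lemma rank_plus_kernel_dim:
  fixes M :: "'a::field mat"
  assumes M: "M \<in> carrier_mat nr nc"
  shows "vec_space.rank nr M + kernel_dim M = nc"
proof -
  interpret V: vec_space "TYPE('a)" nc .
  interpret W: vec_space "TYPE('a)" nr .
  interpret K: kernel nr nc M by unfold_locales (rule M)
  interpret T: linear_map class_ring V.V W.V "\<lambda>x. M *\<^sub>v x"
  proof unfold_locales
    show "(\<lambda>x. M *\<^sub>v x) \<in> LinearCombinations.module_hom class_ring V.V W.V"
      using M unfolding LinearCombinations.module_hom_def
      by (auto simp: module_vec_simps mult_add_distrib_mat_vec mult_mat_vec)
  qed
  have im: "T.imT = W.span (set (cols M))"
    using col_space_eq_image[OF M] by (simp add: T.im_def W.col_space_def)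
  have ker: "T.kerT = mat_kernel M"
    using M by (auto simp: T.ker_def mat_kernel)
  show ?thesis
    using T.rank_nullity V.dim_is_n unfolding im ker
    by (simp add: W.rank_def)
qed

lemma rank_le_nr:
  fixes M :: "'a::field mat"
  assumes M: "M \<in> carrier_mat nr nc"
  shows "vec_space.rank nr M \<le> nr"
proof -
  interpret W: vec_space "TYPE('a)" nr .
  have c: "set (cols M) \<subseteq> carrier_vec nr"
    using cols_dim M by blast
  show ?thesis
    unfolding W.rank_def
    using W.subspace_dim[OF W.span_is_subspace W.fin_dim W.fin_dim_span_cols[OF M]] c W.dim_is_n
    by auto
qed

section \<open>Trivial kernels, the form in which injectivity is used throughout\<close>

lemma kernel_dim_trivial:
  fixes M :: "'a::field mat"
  assumes M: "M \<in> carrier_mat nr nc" and ker: "mat_kernel M = {0\<^sub>v nc}"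
  shows "kernel_dim M = 0"
proof -
  interpret K: kernel nr nc M by unfold_locales (rule M)
  show ?thesis
    \<comment> \<open>\<open>kernel_dim\<close> is the dimension of the kernel as a space of its
      own, so the span of zero is first moved to the ambient space.\<close>
    using K.Ker.dim0I K.span_same[of "{0\<^sub>v nc}"] K.NC.span_zero ker K.kernel_dim by simp
qed

lemma trivial_kernelI:
  fixes M :: "'a::field mat"
  assumes M: "M \<in> carrier_mat nr nc"
    and "\<And>v. v \<in> carrier_vec nc \<Longrightarrow> M *\<^sub>v v = 0\<^sub>v nr \<Longrightarrow> v = 0\<^sub>v nc"
  shows "mat_kernel M = {0\<^sub>v nc}"
proof -
  have "M *\<^sub>v 0\<^sub>v nc = 0\<^sub>v nr"
    using M by (intro eq_vecI) auto
  with assms show ?thesis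
    by (auto simp: mat_kernel[OF M])
qed

text \<open>With nullity 0 the rank is \<open>nc\<close>, and as the dimension of a subspace of an
  \<open>nr\<close>-dimensional space it is at most \<open>nr\<close>.\<close>

lemma trivial_kernel_imp_le:
  fixes M :: "'a::field mat"
  assumes M: "M \<in> carrier_mat nr nc" and ker: "mat_kernel M = {0\<^sub>v nc}"
  shows "nc \<le> nr"
  using rank_plus_kernel_dim[OF M] rank_le_nr[OF M] kernel_dim_trivial[OF M ker] by simp

lemma trivial_kernel_mult_left:
  fixes M N :: "'a::field mat"
  assumes M: "M \<in> carrier_mat nr k" and N: "N \<in> carrier_mat k nc"
    and ker: "mat_kernel (M * N) = {0\<^sub>v nc}"
  shows "mat_kernel N = {0\<^sub>v nc}"
  by (rule trivial_kernelI[OF N])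
    (use mat_kernel_mult_subset[OF N M] ker mat_kernel[OF N] in blast)

lemma trivial_kernel_mult:
  fixes M N :: "'a::field mat"
  assumes M: "M \<in> carrier_mat nr k" and N: "N \<in> carrier_mat k nc"
    and kerM: "mat_kernel M = {0\<^sub>v k}" and kerN: "mat_kernel N = {0\<^sub>v nc}"
  shows "mat_kernel (M * N) = {0\<^sub>v nc}"
proof (rule trivial_kernelI[OF mult_carrier_mat[OF M N]])
  fix v assume v: "v \<in> carrier_vec nc" and "M * N *\<^sub>v v = 0\<^sub>v nr"
  then have "N *\<^sub>v v \<in> mat_kernel M"
    using M N by (auto simp: mat_kernel)
  then have "v \<in> mat_kernel N"
    using kerM N v by (auto simp: mat_kernel)
  then show "v = 0\<^sub>v nc"
    using kerN by simp
qed

section \<open>Column space inclusions as factorisations\<close>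

lemma col_space_mono_iff_factor:
  fixes M N :: "'a::field mat"
  assumes M: "M \<in> carrier_mat nr k" and N: "N \<in> carrier_mat nr l"
  shows "vec_space.col_space nr N \<subseteq> vec_space.col_space nr M \<longleftrightarrow>
    (\<exists>Z \<in> carrier_mat k l. N = M * Z)"
proof
  assume sub: "vec_space.col_space nr N \<subseteq> vec_space.col_space nr M"
  interpret W: vec_space "TYPE('a)" nr .
  have "\<forall>j<l. \<exists>z \<in> carrier_vec k. col N j = M *\<^sub>v z"
  proof (intro allI impI)
    fix j assume "j < l"
    then have "col N j \<in> set (cols N)"
      using N by (auto simp: cols_def)
    moreover have "set (cols N) \<subseteq> carrier_vec nr"
      using N cols_dim by blast
    ultimately have "col N j \<in> vec_space.col_space nr N"
      using W.span_mem by (auto simp: W.col_space_def)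
    then show "\<exists>z \<in> carrier_vec k. col N j = M *\<^sub>v z"
      using sub by (auto simp: col_space_eq_image[OF M])
  qed
  then obtain z where z: "\<And>j. j < l \<Longrightarrow> z j \<in> carrier_vec k \<and> col N j = M *\<^sub>v z j"
    by metis
  \<comment> \<open>Column \<open>j\<close> of \<open>Z\<close> holds the coefficients that express
    column \<open>j\<close> of \<open>N\<close> in the columns of \<open>M\<close>.\<close>
  define Z where "Z = mat_of_cols k (map z [0..<l])"
  have Zc: "Z \<in> carrier_mat k l"
    by (simp add: Z_def carrier_matI)
  have "N = M * Z"
  proof (rule mat_col_eqI)
    fix j assume "j < dim_col (M * Z)"
    then have j: "j < l" using Zc by simp
    have "col Z j = z j" using z[OF j] j by (simp add: Z_def)
    then show "col N j = col (M * Z) j"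
      using z[OF j] col_mult2[OF M Zc j] by simp
  qed (use M N Zc in auto)
  with Zc show "\<exists>Z \<in> carrier_mat k l. N = M * Z" by blast
next
  assume "\<exists>Z \<in> carrier_mat k l. N = M * Z"
  then show "vec_space.col_space nr N \<subseteq> vec_space.col_space nr M"
    using M by (auto simp: col_space_eq_image[OF M] col_space_eq_image[OF N])
qed

lemma trivial_kernel_square_right_inverse:
  fixes Y :: "'a::field mat"
  assumes Y: "Y \<in> carrier_mat n n" and ker: "mat_kernel Y = {0\<^sub>v n}"
  obtains Z where "Z \<in> carrier_mat n n" "Y * Z = 1\<^sub>m n"
proof -
  have "det Y \<noteq> 0"
    using ker det_0_iff_vec_prod_zero_field[OF Y] by (auto simp: mat_kernel[OF Y])
  then show ?thesis
    \<comment> \<open>\<open>undefined\<close> only fills the extension slot of the ring record; the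
      units do not depend on it.\<close>
    using that det_non_zero_imp_unit[OF Y, of undefined] 
    by (auto simp: Units_def ring_mat_def)
qed

section \<open>The matrices of independent columns and of kernel bases\<close>

lemma
  fixes B D :: "'a::field mat"
  assumes B: "B \<in> carrier_mat n p" and D: "max_indep_columns B D"
  shows max_indep_columns_carrier: "D \<in> carrier_mat n (vec_space.rank n B)"
    and max_indep_columns_kernel: "mat_kernel D = {0\<^sub>v (vec_space.rank n B)}"
    and max_indep_columns_col_space: "vec_space.col_space n D = vec_space.col_space n B"
proof -
  interpret vec_space "TYPE('a)" n .
  have Dc: "D \<in> carrier_mat n (rank B)" and sub: "set (cols D) \<subseteq> set (cols B)"
    and dist: "distinct (cols D)" and ind: "lin_indpt (set (cols D))"
    using D B by (auto simp: max_indep_columns_def)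
  show "D \<in> carrier_mat n (rank B)" by (rule Dc)
  show "mat_kernel D = {0\<^sub>v (rank B)}"
    \<comment> \<open>A nonzero vector in the kernel lists the coefficients of a dependence between
      the columns. As these are distinct, it is a dependence of their set.\<close>
    by (rule trivial_kernelI[OF Dc]) (use lin_depI[OF Dc _ _ _ dist] ind in blast)
  have Bsub: "set (cols B) \<subseteq> carrier_vec n" and Dsub: "set (cols D) \<subseteq> carrier_vec n"
    using B Dc cols_dim by blast+
  have cardD: "card (set (cols D)) = rank B"
    using dist Dc by (simp add: distinct_card)
  \<comment> \<open>A column of \<open>B\<close> outside this span would extend the columns of
    \<open>D\<close> to \<open>rank B + 1\<close> independent columns of \<open>B\<close>, more than
    the rank allows.\<close>
  have "b \<in> span (set (cols D))" if b: "b \<in> set (cols B)" for b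
  proof (rule ccontr)
    assume nb: "b \<notin> span (set (cols D))"
    then have nbD: "b \<notin> set (cols D)"
      using span_mem[OF Dsub] by blast
    have "lin_indpt (insert b (set (cols D)))"
      using lin_dep_iff_in_span[OF Dsub ind _ nbD] b Bsub nb by auto
    then have "card (insert b (set (cols D))) \<le> rank B"
      using rank_ge_card_indpt[OF B] b sub by auto
    then show False using nbD cardD by simp
  qed
  then have "span (set (cols B)) \<subseteq> span (set (cols D))"
    by (intro span_subsetI) (use Dsub in auto)
  moreover have "span (set (cols D)) \<subseteq> span (set (cols B))"
    using span_is_monotone[OF sub] .
  ultimately show "col_space D = col_space B"
    by (simp add: col_space_def)
qed

text \<open>\<open>basis\<close> refers to the kernel as a space of its own. Span and linear
  dependence of vectors of the kernel are the same there as in the ambient space, and distinctness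
  makes \<open>dim_col V\<close> the size of the basis.\<close>

lemma
  fixes M V :: "'a::field mat"
  assumes M: "M \<in> carrier_mat nr nc" and V: "kernel_basis_mat M V"
  shows kernel_basis_mat_carrier: "V \<in> carrier_mat nc (dim_col V)"
    and kernel_basis_mat_kernel: "mat_kernel V = {0\<^sub>v (dim_col V)}"
    and kernel_basis_mat_col_space: "vec_space.col_space nc V = mat_kernel M"
    and kernel_basis_mat_dim: "dim_col V = kernel_dim M"
proof -
  interpret K: kernel nr nc M by unfold_locales (rule M)
  have Vr: "dim_row V = nc" and dist: "distinct (cols V)" and bas: "K.basis (set (cols V))"
    using V M by (auto simp: kernel_basis_mat_def)
  show Vc: "V \<in> carrier_mat nc (dim_col V)" using Vr by auto
  have sub: "set (cols V) \<subseteq> mat_kernel M" and ind: "K.lin_indpt (set (cols V))"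
    and gen: "K.span (set (cols V)) = mat_kernel M"
    using bas by (auto simp: K.Ker.basis_def)
  have "K.NC.lin_indpt (set (cols V))"
    using ind K.lindep_same[OF sub] by simp
  then show "mat_kernel V = {0\<^sub>v (dim_col V)}"
    by (intro trivial_kernelI[OF Vc]) (use K.NC.lin_depI[OF Vc _ _ _ dist] in blast)
  show "K.NC.col_space V = mat_kernel M"
    using gen K.span_same[OF sub] by (simp add: K.NC.col_space_def)
  show "dim_col V = kernel_dim M"
    using K.Ker.dim_basis[OF _ bas] dist by (simp add: distinct_card)
qed

text \<open>\<open>D\<close> is injective with the column space of \<open>B\<close>, so it carries a
  basis of the kernel of \<open>A * D\<close> to a basis of the vectors in that column space which
  \<open>A\<close> annihilates. The rank formula is rank-nullity for \<open>A * D\<close>, which has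
  \<open>rank B\<close> columns.\<close>

lemma
  fixes A B D V :: "'a::field mat"
  assumes A: "A \<in> carrier_mat m n" and B: "B \<in> carrier_mat n p"
    and D: "max_indep_columns B D" and V: "kernel_basis_mat (A * D) V"
  shows indep_columns_mult_kernel_basis_carrier: "D * V \<in> carrier_mat n (dim_col V)"
    and indep_columns_mult_kernel_basis_kernel: "mat_kernel (D * V) = {0\<^sub>v (dim_col V)}"
    and indep_columns_mult_kernel_basis_col_space: "vec_space.col_space n (D * V) = vec_space.col_space n B \<inter> mat_kernel A"
    and indep_columns_mult_kernel_basis_rank: "vec_space.rank m (A * B) + dim_col V = vec_space.rank n B"
proof -
  define r where "r = vec_space.rank n B"
  have Dc: "D \<in> carrier_mat n r" and Dk: "mat_kernel D = {0\<^sub>v r}"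
    and Ds: "vec_space.col_space n D = vec_space.col_space n B"
    using max_indep_columns_carrier[OF B D] max_indep_columns_kernel[OF B D]
      max_indep_columns_col_space[OF B D] by (auto simp: r_def)
  have AD: "A * D \<in> carrier_mat m r" using A Dc by auto
  note Vc = kernel_basis_mat_carrier[OF AD V]
  show DV: "D * V \<in> carrier_mat n (dim_col V)" by (rule mult_carrier_mat[OF Dc Vc])
  show "mat_kernel (D * V) = {0\<^sub>v (dim_col V)}"
    by (rule trivial_kernel_mult[OF Dc Vc Dk kernel_basis_mat_kernel[OF AD V]])
  have "vec_space.col_space n (D * V) = (\<lambda>x. D *\<^sub>v x) ` vec_space.col_space r V"
    unfolding col_space_eq_image[OF DV] col_space_eq_image[OF Vc] image_image
    by (intro image_cong refl assoc_mult_mat_vec[OF Dc Vc])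
  \<comment> \<open>For \<open>x = D *\<^sub>v v\<close>, the vector \<open>x\<close> is annihilated
    by \<open>A\<close> exactly when \<open>v\<close> is annihilated by
    \<open>A * D\<close>.\<close>
  also have "\<dots> = (\<lambda>x. D *\<^sub>v x) ` carrier_vec r \<inter> mat_kernel A"
    unfolding kernel_basis_mat_col_space[OF AD V] mat_kernel[OF AD] mat_kernel[OF A]
    using assoc_mult_mat_vec[OF A Dc] mult_mat_vec_carrier[OF Dc] by (auto simp: image_iff)
  finally show "vec_space.col_space n (D * V) = vec_space.col_space n B \<inter> mat_kernel A"
    by (simp add: Ds[symmetric] col_space_eq_image[OF Dc])
  have AB: "A * B \<in> carrier_mat m p" using A B by auto
  \<comment> \<open>Both \<open>A * D\<close> and \<open>A * B\<close> have as column space the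
    image under \<open>A\<close> of the column space shared by \<open>D\<close> and
    \<open>B\<close>.\<close>
  have "vec_space.col_space m (A * D) = (\<lambda>x. A *\<^sub>v x) ` vec_space.col_space n D"
    unfolding col_space_eq_image[OF AD] col_space_eq_image[OF Dc] image_image
    by (intro image_cong refl assoc_mult_mat_vec[OF A Dc])
  also have "\<dots> = vec_space.col_space m (A * B)"
    unfolding Ds col_space_eq_image[OF AB] col_space_eq_image[OF B] image_image
    by (intro image_cong refl assoc_mult_mat_vec[OF A B, symmetric])
  finally have "vec_space.rank m (A * D) = vec_space.rank m (A * B)"
    by (rule rank_eq_if_col_space_eq)
  then show "vec_space.rank m (A * B) + dim_col V = vec_space.rank n B"
    using rank_plus_kernel_dim[OF AD] kernel_basis_mat_dim[OF AD V] by (simp add: r_def)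
qed

theorem theorem5:
  fixes A B C D\<^sub>B D\<^sub>B\<^sub>C V\<^sub>B V\<^sub>B\<^sub>C :: "'a::field mat"
    and m n p q :: nat
  assumes "A \<in> carrier_mat m n"
    and "B \<in> carrier_mat n p"
    and "C \<in> carrier_mat p q"
    and "max_indep_columns B D\<^sub>B"
    and "max_indep_columns (B * C) D\<^sub>B\<^sub>C"
    and "kernel_basis_mat (A * D\<^sub>B) V\<^sub>B"
    and "kernel_basis_mat (A * D\<^sub>B\<^sub>C) V\<^sub>B\<^sub>C"
  shows "vec_space.rank m (A * B * C) + vec_space.rank n B
           = vec_space.rank m (A * B) + vec_space.rank n (B * C)
     \<longleftrightarrow> (\<exists>Z \<in> carrier_mat (dim_col V\<^sub>B\<^sub>C) (dim_col V\<^sub>B). D\<^sub>B * V\<^sub>B = D\<^sub>B\<^sub>C * V\<^sub>B\<^sub>C * Z)"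
proof -
  note A = assms(1) and B = assms(2) and C = assms(3)
  have BC: "B * C \<in> carrier_mat n q" using B C by auto
  define P k where "P = D\<^sub>B * V\<^sub>B" and "k = dim_col V\<^sub>B"
  define Q l where "Q = D\<^sub>B\<^sub>C * V\<^sub>B\<^sub>C" and "l = dim_col V\<^sub>B\<^sub>C"
  note P = indep_columns_mult_kernel_basis_carrier[OF A B assms(4,6), folded P_def k_def]
    indep_columns_mult_kernel_basis_kernel[OF A B assms(4,6), folded P_def k_def]
    indep_columns_mult_kernel_basis_col_space[OF A B assms(4,6), folded P_def k_def]
    indep_columns_mult_kernel_basis_rank[OF A B assms(4,6), folded P_def k_def]
  note Q = indep_columns_mult_kernel_basis_carrier[OF A BC assms(5,7), folded Q_def l_def]
    indep_columns_mult_kernel_basis_kernel[OF A BC assms(5,7), folded Q_def l_def]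
    indep_columns_mult_kernel_basis_col_space[OF A BC assms(5,7), folded Q_def l_def]
    indep_columns_mult_kernel_basis_rank[OF A BC assms(5,7), folded Q_def l_def]
  have "vec_space.col_space n (B * C) \<subseteq> vec_space.col_space n B"
    unfolding col_space_mono_iff_factor[OF B BC] using C by blast
  then have "vec_space.col_space n Q \<subseteq> vec_space.col_space n P"
    unfolding P(3) Q(3) by blast
  then obtain Y where Y: "Y \<in> carrier_mat k l" and QPY: "Q = P * Y"
    using col_space_mono_iff_factor[OF P(1) Q(1)] by blast
  have Yk: "mat_kernel Y = {0\<^sub>v l}"
    using trivial_kernel_mult_left[OF P(1) Y] Q(2) QPY by simp
  then have "l \<le> k"
    by (rule trivial_kernel_imp_le[OF Y])
  \<comment> \<open>By \<open>P(4)\<close> and \<open>Q(4)\<close>, \<open>k\<close> and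
    \<open>l\<close> are the drops in rank from \<open>B\<close> to \<open>A * B\<close> and from
    \<open>B * C\<close> to \<open>A * B * C\<close>; the rank identity says that they
    agree.\<close>
  have "k = l \<longleftrightarrow> (\<exists>Z \<in> carrier_mat l k. P = Q * Z)"
  proof
    assume kl: "k = l"
    then obtain Z where "Z \<in> carrier_mat l k" "Y * Z = 1\<^sub>m k"
      using trivial_kernel_square_right_inverse[of Y k] Y Yk by auto
    then show "\<exists>Z \<in> carrier_mat l k. P = Q * Z"
      \<comment> \<open>\<open>Q * Z = P * (Y * Z) = P\<close>.\<close>
      using QPY P(1) Y by (intro bexI[of _ Z]) (auto simp: assoc_mult_mat[of _ n k _ l _ k])
  next
    assume "\<exists>Z \<in> carrier_mat l k. P = Q * Z"
    then obtain Z where Z: "Z \<in> carrier_mat l k" and "P = Q * Z" by blast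
    \<comment> \<open>\<open>P = Q * Z\<close> is injective, hence so is its right factor
      \<open>Z\<close>.\<close>
    then have "mat_kernel Z = {0\<^sub>v k}"
      using trivial_kernel_mult_left[OF Q(1) Z] P(2) by simp
    then have "k \<le> l"
      by (rule trivial_kernel_imp_le[OF Z])
    with \<open>l \<le> k\<close> show "k = l" by simp
  qed
  moreover have "A * B * C = A * (B * C)"
    using A B C by (rule assoc_mult_mat)
  ultimately show ?thesis
    using P(4) Q(4) by (auto simp: P_def Q_def k_def l_def)
qed

end
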